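(* For every $\leq_{fe}$-minimal ultrafilter $\mathcal{F}\in\beta\mathbb{N}\setminus\mathbb{N}$ and every $n\in\mathbb{N}$, the ultrafilter $\mathcal{F}^n$ is also $\leq_{fe}$-minimal.
   Context: $\mathbb{N}$ is the set of positive integers and $\beta\mathbb{N}$ is the set of all ultrafilters on $\mathbb{N}$; each $n\in\mathbb{N}$ is identified with the principal ultrafilter $\{A\subseteq\mathbb{N}:n\in A\}$. For $A\subseteq\mathbb{N}$ and $n,k\in\mathbb{N}$: $A^n=\{a^n:a\in A\}$, $kA=\{ka:a\in A\}$. For $\mathcal{F}\in\beta\mathbb{N}$, $\mathcal{F}^n$ is the ultrafilter on $\mathbb{N}$ generated by $\{A^n:A\in\mathcal{F}\}$. For $A,B\subseteq\mathbb{N}$, $A\leq_{fe}B$ means that for every finite $F\subseteq A$ there is $k\in\mathbb{N}$ with $kF\subseteq B$. For $\mathcal{F},\mathcal{G}\in\beta\mathbb{N}$, $\mathcal{F}\leq_{fe}\mathcal{G}$ means that for every $B\in\mathcal{G}$ there is $A\in\mathcal{F}$ with $A\leq_{fe}B$. Write $\mathcal{F}<_{fe}\mathcal{G}$ if $\mathcal{F}\leq_{fe}\mathcal{G}$ but not $\mathcal{G}\leq_{fe}\mathcal{F}$. When speaking of minimal elements, the (trivially smallest) element $1$ is excluded: $\mathcal{F}\in\beta\mathbb{N}\setminus\{1\}$ is $\leq_{fe}$-minimal if there is no $\mathcal{G}\in\beta\mathbb{N}\setminus\{1\}$ with $\mathcal{G}<_{fe}\mathcal{F}$. *)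

theory Defs
  imports Complex_Main
begin

abbreviation Npos :: "nat set" where
  "Npos \<equiv> {n. 0 < n}"

definition ultrafilter :: "'a filter \<Rightarrow> bool" where
  "ultrafilter F \<longleftrightarrow>
     F \<noteq> bot \<and> (\<forall>P. eventually P F \<or> eventually (\<lambda>x. \<not> P x) F)"

text \<open>
  An ultrafilter on the positive integers is encoded as an ultrafilter on the type
  \<^typ>\<open>nat\<close> that contains the set of positive integers.
  The ultrafilter identified with a positive integer n is \<open>principal {n}\<close>.
\<close>

definition betaN :: "nat filter set" where
  "betaN = {F. ultrafilter F \<and> F \<le> principal Npos}"

text \<open>The members of an ultrafilter as subsets of the positive integers (so 0 is discarded).\<close>

definition members :: "nat filter \<Rightarrow> nat set set" where
  "members F = {A. A \<subseteq> Npos \<and> eventually (\<lambda>x. x \<in> A) F}"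

definition set_pow :: "nat set \<Rightarrow> nat \<Rightarrow> nat set" where
  "set_pow A n = (\<lambda>a. a ^ n) ` A"

definition set_mult :: "nat \<Rightarrow> nat set \<Rightarrow> nat set" where
  "set_mult k A = (\<lambda>a. k * a) ` A"

text \<open>
  The filter generated by a family of sets is the infimum of their principal filters:
  \<^typ>\<open>'a filter\<close> is ordered by reverse inclusion of the families of members.
\<close>

definition filter_pow :: "nat filter \<Rightarrow> nat \<Rightarrow> nat filter" where
  "filter_pow F n = (INF A\<in>members F. principal (set_pow A n))"

definition fe_set_le :: "nat set \<Rightarrow> nat set \<Rightarrow> bool" where
  "fe_set_le A B \<longleftrightarrow>
     (\<forall>S. finite S \<and> S \<subseteq> A \<longrightarrow> (\<exists>k\<in>Npos. set_mult k S \<subseteq> B))"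

definition fe_le :: "nat filter \<Rightarrow> nat filter \<Rightarrow> bool" where
  "fe_le F G \<longleftrightarrow> (\<forall>B\<in>members G. \<exists>A\<in>members F. fe_set_le A B)"

definition fe_less :: "nat filter \<Rightarrow> nat filter \<Rightarrow> bool" where
  "fe_less F G \<longleftrightarrow> fe_le F G \<and> \<not> fe_le G F"

definition fe_minimal :: "nat filter \<Rightarrow> bool" where
  "fe_minimal F \<longleftrightarrow>
     F \<in> betaN - {principal {1}} \<and>
     \<not> (\<exists>G \<in> betaN - {principal {1}}. fe_less G F)"

end

theory Submission
  imports Defs "HOL-Computational_Algebra.Primes"
begin

text \<open>
  Throughout, \<open>F\<^sup>n\<close> is the image of \<open>F\<close> under \<open>x \<mapsto> x ^ n\<close>. The point is that everything
  below \<open>F\<^sup>n\<close> is, up to a constant factor, again an \<open>n\<close>-th power of something below \<open>F\<close>.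

  Let \<open>G \<noteq> 1\<close> be below \<open>F\<^sup>n\<close>. Some member of \<open>G\<close> embeds finitely into the set of \<open>n\<close>-th powers,
  so the quotient of any two of its elements is the \<open>n\<close>-th power of a rational number; hence
  all its elements have the same \<open>n\<close>-th-power-free part \<open>c\<close>
  (\<open>common_factor_if_embeds_in_powers\<close>). Thus \<open>G = c H\<^sup>n\<close> for an ultrafilter \<open>H\<close>, and taking \<open>n\<close>-th
  roots of embeddings shows that \<open>H\<close> is below \<open>F\<close> (\<open>fe_le_root\<close>).

  If \<open>H \<noteq> 1\<close>, minimality puts \<open>F\<close> below \<open>H\<close>, and taking powers and multiplying by \<open>c\<close> puts \<open>F\<^sup>n\<close>
  below \<open>c H\<^sup>n = G\<close> (\<open>fe_le_filtermap_power\<close>). If \<open>H = 1\<close>, then \<open>G\<close> is the number \<open>c > 1\<close>; for a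
  prime \<open>p\<close> dividing \<open>c\<close>, every member of \<open>F\<close> contains a multiple of \<open>p\<close>, so \<open>p\<close> is below \<open>F\<close>.
  Minimality then puts \<open>F\<close> below \<open>p\<close>, which is impossible for a nonprincipal \<open>F\<close>
  (\<open>principal_if_fe_le_principal\<close>).
\<close>

section \<open>Ultrafilters on the positive integers\<close>

lemma eventually_pos_betaN: "F \<in> betaN \<Longrightarrow> eventually (\<lambda>x. 0 < x) F"
  by (simp add: betaN_def le_principal)

lemma betaN_neq_bot: "F \<in> betaN \<Longrightarrow> F \<noteq> bot"
  by (simp add: betaN_def ultrafilter_def)

lemma members_nonempty: "F \<in> betaN \<Longrightarrow> A \<in> members F \<Longrightarrow> A \<noteq> {}"
  by (auto simp: members_def dest: betaN_neq_bot)

lemma principal_in_betaN: "0 < a \<Longrightarrow> principal {a} \<in> betaN"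
  by (auto simp: betaN_def ultrafilter_def eventually_principal principal_eq_bot_iff)

lemma ultrafilter_filtermap: "ultrafilter F \<Longrightarrow> ultrafilter (filtermap f F)"
  by (auto simp: ultrafilter_def eventually_filtermap filtermap_bot_iff)

lemma filtermap_in_betaN:
  assumes "F \<in> betaN" "eventually (\<lambda>x. 0 < f x) F"
  shows "filtermap f F \<in> betaN"
  using assms
  by (simp add: betaN_def ultrafilter_filtermap le_principal eventually_filtermap)

lemma betaN_eq_principal:
  assumes "F \<in> betaN" "eventually (\<lambda>x. x = a) F"
  shows "F = principal {a}"
proof (rule filter_eqI)
  fix P
  have "\<not> eventually P F" if "\<not> P a"
  proof
    assume "eventually P F"
    with assms(2) have "eventually (\<lambda>x. False) F"
      by eventually_elim (use that in auto)
    with betaN_neq_bot[OF assms(1)] show False by simp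
  qed
  moreover have "eventually P F" if "P a"
    using assms(2) by eventually_elim (use that in simp)
  ultimately show "eventually P F = eventually P (principal {a})"
    by (auto simp: eventually_principal)
qed

lemma filter_pow_eq_filtermap:
  assumes "F \<in> betaN"
  shows "filter_pow F n = filtermap (\<lambda>x. x ^ n) F"
proof (rule filter_eqI)
  fix P
  have pos: "Npos \<in> members F"
    using eventually_pos_betaN[OF assms] by (simp add: members_def)
  have "eventually P (filter_pow F n)
      \<longleftrightarrow> (\<exists>A\<in>members F. eventually P (principal (set_pow A n)))"
    unfolding filter_pow_def
  proof (rule eventually_INF_base)
    show "members F \<noteq> {}" using pos by blast
    fix A B assume "A \<in> members F" "B \<in> members F"
    then have "A \<inter> B \<in> members F"
      by (auto simp: members_def eventually_conj_iff)
    then show "\<exists>C\<in>members F. principal (set_pow C n)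
        \<le> inf (principal (set_pow A n)) (principal (set_pow B n))"
      by (intro bexI[of _ "A \<inter> B"]) (auto simp: set_pow_def)
  qed
  also have "\<dots> \<longleftrightarrow> eventually (\<lambda>x. P (x ^ n)) F"
  proof
    assume "\<exists>A\<in>members F. eventually P (principal (set_pow A n))"
    then obtain A where "eventually (\<lambda>x. x \<in> A) F" "\<forall>x\<in>A. P (x ^ n)"
      by (auto simp: members_def eventually_principal set_pow_def)
    then show "eventually (\<lambda>x. P (x ^ n)) F"
      by (auto elim: eventually_mono)
  next
    assume "eventually (\<lambda>x. P (x ^ n)) F"
    then have "{x. 0 < x \<and> P (x ^ n)} \<in> members F"
      using eventually_pos_betaN[OF assms] by (auto simp: members_def eventually_conj_iff)
    then show "\<exists>A\<in>members F. eventually P (principal (set_pow A n))"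
      by (rule bexI[rotated]) (auto simp: eventually_principal set_pow_def)
  qed
  finally show "eventually P (filter_pow F n) = eventually P (filtermap (\<lambda>x. x ^ n) F)"
    by (simp add: eventually_filtermap)
qed

lemma set_pow_in_members_filtermap:
  assumes "F \<in> betaN" "A \<in> members F"
  shows "set_pow A n \<in> members (filtermap (\<lambda>x. x ^ n) F)"
  using assms by (auto simp: members_def set_pow_def eventually_filtermap elim: eventually_mono)

section \<open>Embeddings into sets of powers\<close>

lemma fe_set_leD:
  assumes "fe_set_le A B" "finite S \<and> S \<subseteq> A"
  shows "\<exists>k>0. set_mult k S \<subseteq> B"
  using assms unfolding fe_set_le_def by (metis mem_Collect_eq)

text \<open>
  The common factor is the \<open>n\<close>-th-power-free part of a fixed \<open>a0 \<in> A\<close>, taken as the least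
  positive \<open>c\<close> for which \<open>a0 / c\<close> is an \<open>n\<close>-th power. Any other \<open>a \<in> A\<close> can be moved, together
  with \<open>a0\<close>, to two \<open>n\<close>-th powers, so \<open>a / c\<close> is the \<open>n\<close>-th power of a fraction; in lowest terms
  its denominator could be moved from \<open>c\<close> into the root of \<open>a0 / c\<close>, and so is \<open>1\<close> by leastness.
\<close>
lemma common_factor_if_embeds_in_powers:
  assumes A: "A \<subseteq> Npos" "A \<noteq> {}" and n: "0 < n"
    and emb: "fe_set_le A (set_pow Npos n)"
  shows "\<exists>c>0. \<forall>a\<in>A. \<exists>x>0. a = c * x ^ n"
proof -
  obtain a0 where a0: "a0 \<in> A" using A by blast
  define Q where "Q = (\<lambda>c. 0 < c \<and> (\<exists>x>0. a0 = c * x ^ n))"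
  define c where "c = (LEAST c. Q c)"
  have "Q a0"
    using a0 A by (auto simp: Q_def intro!: exI[of _ 1])
  then have "Q c" unfolding c_def by (rule LeastI)
  then obtain x0 where c: "0 < c" and x0: "0 < x0" "a0 = c * x0 ^ n"
    by (auto simp: Q_def)
  have "\<exists>x>0. a = c * x ^ n" if a: "a \<in> A" for a
  proof -
    have "finite {a0, a} \<and> {a0, a} \<subseteq> A" using a a0 by simp
    from fe_set_leD[OF emb this]
    obtain k where k: "0 < k" "set_mult k {a0, a} \<subseteq> set_pow Npos n"
      by blast
    then obtain u v where u: "0 < u" "k * a0 = u ^ n" and v: "0 < v" "k * a = v ^ n"
      by (auto simp: set_mult_def set_pow_def)
    have "k * (a * u ^ n) = k * (a0 * v ^ n)"
      using u(2) v(2) by (metis mult.assoc mult.commute)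
    then have eq: "a * u ^ n = c * (x0 * v) ^ n"
      using k(1) x0(2) by (simp add: power_mult_distrib algebra_simps)
    define g where "g = gcd u (x0 * v)"
    have g: "0 < g" using u(1) by (simp add: g_def)
    obtain u' v' where uv': "u = u' * g" "x0 * v = v' * g" "coprime u' v'"
      using gcd_coprime_exists[of u "x0 * v"] g unfolding g_def by auto
    have pos: "0 < u'" "0 < v'"
      using u(1) v(1) x0(1) uv'(1,2) by (auto intro!: Nat.gr0I)
    have eq': "a * u' ^ n = c * v' ^ n"
      using eq g by (simp add: uv' power_mult_distrib)
    then have "u' ^ n dvd c * v' ^ n" by (metis dvd_triv_right)
    then have "u' ^ n dvd c"
      using uv'(3) by (simp add: coprime_dvd_mult_left_iff)
    then obtain c' where c': "c = c' * u' ^ n" by (metis dvd_div_mult_self)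
    then have "Q c'"
      using c x0 pos(1)
      by (auto simp: Q_def power_mult_distrib intro!: exI[of _ "u' * x0"])
    then have "c \<le> c'" unfolding c_def by (rule Least_le)
    then have "u' ^ n = 1"
      using c c' by (cases "u' ^ n") auto
    with eq' pos(2) show ?thesis by auto
  qed
  with c show ?thesis by blast
qed

text \<open>
  If \<open>k c x\<^sup>n = b\<^sup>n\<close> for a single \<open>x\<close>, then \<open>k c\<close> is already an \<open>n\<close>-th power \<open>m\<^sup>n\<close>, and the one
  factor \<open>m\<close> moves the roots of all elements under consideration into \<open>B\<close>.
\<close>
lemma fe_set_le_root:
  assumes n: "0 < n" and c: "0 < c" and B: "B \<subseteq> Npos"
    and emb: "fe_set_le A (set_pow B n)"
  shows "fe_set_le {x. 0 < x \<and> c * x ^ n \<in> A} B"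
  unfolding fe_set_le_def
proof (intro allI impI)
  fix S assume S: "finite S \<and> S \<subseteq> {x. 0 < x \<and> c * x ^ n \<in> A}"
  show "\<exists>m\<in>Npos. set_mult m S \<subseteq> B"
  proof (cases "S = {}")
    case True
    then show ?thesis by (auto simp: set_mult_def)
  next
    case False
    then obtain x where x: "x \<in> S" by blast
    have "finite ((\<lambda>x. c * x ^ n) ` S) \<and> (\<lambda>x. c * x ^ n) ` S \<subseteq> A"
      using S by auto
    from fe_set_leD[OF emb this]
    obtain k where k: "0 < k" "set_mult k ((\<lambda>x. c * x ^ n) ` S) \<subseteq> set_pow B n"
      by blast
    have move: "\<exists>b\<in>B. k * (c * y ^ n) = b ^ n" if "y \<in> S" for y
      using k(2) that by (force simp: set_mult_def set_pow_def)
    obtain b where b: "b \<in> B" "k * (c * x ^ n) = b ^ n"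
      using move[OF x] by blast
    have "x ^ n dvd b ^ n" using b(2) by (metis dvd_triv_right mult.assoc)
    then obtain m where m: "b = x * m" using n by (auto simp: pow_divides_pow_iff)
    have "0 < x" using S x by auto
    then have kc: "k * c = m ^ n"
      using b(2) m by (simp add: power_mult_distrib)
    have "0 < m" using b(1) B m by (auto intro!: Nat.gr0I)
    moreover have "m * y \<in> B" if y: "y \<in> S" for y
    proof -
      obtain b' where b': "b' \<in> B" "k * (c * y ^ n) = b' ^ n"
        using move[OF y] by blast
      then have "(m * y) ^ n = b' ^ n"
        using kc by (metis mult.assoc power_mult_distrib)
      then show ?thesis using b'(1) n by (simp add: power_eq_iff_eq_base)
    qed
    ultimately show ?thesis by (auto simp: set_mult_def)
  qed
qed

section \<open>Finite embeddability of powers of ultrafilters\<close>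

lemma fe_le_root:
  assumes F: "F \<in> betaN" and H: "H \<in> betaN" and n: "0 < n" and c: "0 < c"
    and le: "fe_le (filtermap (\<lambda>x. c * x ^ n) H) (filtermap (\<lambda>x. x ^ n) F)"
  shows "fe_le H F"
  unfolding fe_le_def
proof
  fix B assume B: "B \<in> members F"
  then obtain A where A: "A \<in> members (filtermap (\<lambda>x. c * x ^ n) H)"
      "fe_set_le A (set_pow B n)"
    using le set_pow_in_members_filtermap[OF F B] by (auto simp: fe_le_def)
  have "{x. 0 < x \<and> c * x ^ n \<in> A} \<in> members H"
    using A(1) eventually_pos_betaN[OF H]
    by (auto simp: members_def eventually_filtermap eventually_conj_iff)
  moreover have "fe_set_le {x. 0 < x \<and> c * x ^ n \<in> A} B"
    using fe_set_le_root[OF n c _ A(2)] B by (simp add: members_def)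
  ultimately show "\<exists>A\<in>members H. fe_set_le A B" by blast
qed

text \<open>An embedding by the factor \<open>k\<close> becomes one by the factor \<open>c k\<^sup>n\<close>.\<close>
lemma fe_le_filtermap_power:
  assumes F: "F \<in> betaN" and H: "H \<in> betaN" and c: "0 < c"
    and le: "fe_le F H"
  shows "fe_le (filtermap (\<lambda>x. x ^ n) F) (filtermap (\<lambda>x. c * x ^ n) H)"
  unfolding fe_le_def
proof
  fix B assume B: "B \<in> members (filtermap (\<lambda>x. c * x ^ n) H)"
  then have "{x. 0 < x \<and> c * x ^ n \<in> B} \<in> members H"
    using eventually_pos_betaN[OF H]
    by (auto simp: members_def eventually_filtermap eventually_conj_iff)
  then obtain A where A: "A \<in> members F" "fe_set_le A {x. 0 < x \<and> c * x ^ n \<in> B}"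
    using le by (auto simp: fe_le_def)
  have "fe_set_le (set_pow A n) B"
    unfolding fe_set_le_def
  proof (intro allI impI)
    fix S assume "finite S \<and> S \<subseteq> set_pow A n"
    then obtain T where T: "T \<subseteq> A" "finite T" "S = (\<lambda>x. x ^ n) ` T"
      unfolding set_pow_def by (meson finite_subset_image)
    then have "finite T \<and> T \<subseteq> A" by blast
    from fe_set_leD[OF A(2) this]
    obtain k where k: "0 < k" "set_mult k T \<subseteq> {x. 0 < x \<and> c * x ^ n \<in> B}"
      by blast
    then have "set_mult (c * k ^ n) S \<subseteq> B"
      by (auto simp: T(3) set_mult_def power_mult_distrib mult.assoc)
    moreover have "0 < c * k ^ n" using c k by simp
    ultimately show "\<exists>k\<in>Npos. set_mult k S \<subseteq> B" by blast
  qed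
  then show "\<exists>A\<in>members (filtermap (\<lambda>x. x ^ n) F). fe_set_le A B"
    using set_pow_in_members_filtermap[OF F A(1)] by blast
qed

text \<open>
  Multiplication by a positive number is injective, so a set that embeds into a
  singleton has at most one element.
\<close>
lemma principal_if_fe_le_principal:
  assumes F: "F \<in> betaN" and p: "0 < p" and le: "fe_le F (principal {p})"
  shows "\<exists>a>0. F = principal {a}"
proof -
  have "{p} \<in> members (principal {p})"
    using p by (simp add: members_def eventually_principal)
  then obtain A where A: "A \<in> members F" "fe_set_le A {p}"
    using le by (auto simp: fe_le_def)
  obtain a where a: "a \<in> A" using members_nonempty[OF F A(1)] by blast
  have eq: "x = a" if "x \<in> A" for x
  proof -
    have "finite {a, x} \<and> {a, x} \<subseteq> A" using a that by simp
    from fe_set_leD[OF A(2) this] obtain k where "0 < k" "set_mult k {a, x} \<subseteq> {p}"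
      by blast
    then have "0 < k" "k * x = k * a" by (auto simp: set_mult_def)
    then show ?thesis by simp
  qed
  have "eventually (\<lambda>x. x \<in> A) F" using A(1) by (simp add: members_def)
  then have "eventually (\<lambda>x. x = a) F" by eventually_elim (rule eq)
  then have "F = principal {a}" by (rule betaN_eq_principal[OF F])
  moreover have "0 < a" using A(1) a by (auto simp: members_def)
  ultimately show ?thesis by blast
qed

text \<open>
  The constant \<open>c\<close> comes from a member of \<open>G\<close> that embeds into the set of all \<open>n\<close>-th powers;
  \<open>H\<close> is the image of \<open>G\<close> under a left inverse of \<open>x \<mapsto> c x\<^sup>n\<close>.
\<close>
lemma below_power_is_multiple_of_power:
  assumes F: "F \<in> betaN" and G: "G \<in> betaN" and n: "0 < n"
    and le: "fe_le G (filtermap (\<lambda>x. x ^ n) F)"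
  shows "\<exists>c>0. \<exists>H\<in>betaN. G = filtermap (\<lambda>x. c * x ^ n) H"
proof -
  have "Npos \<in> members F"
    using eventually_pos_betaN[OF F] by (simp add: members_def)
  then have "set_pow Npos n \<in> members (filtermap (\<lambda>x. x ^ n) F)"
    by (rule set_pow_in_members_filtermap[OF F])
  then obtain A where A: "A \<in> members G" "fe_set_le A (set_pow Npos n)"
    using le by (auto simp: fe_le_def)
  have "A \<subseteq> Npos" using A(1) by (simp add: members_def)
  then obtain c where c: "0 < c" "\<forall>a\<in>A. \<exists>x>0. a = c * x ^ n"
    using common_factor_if_embeds_in_powers[OF _ members_nonempty[OF G A(1)] n A(2)] by blast
  then obtain r where r: "\<And>a. a \<in> A \<Longrightarrow> 0 < r a \<and> a = c * r a ^ n"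
    by metis
  have evA: "eventually (\<lambda>x. x \<in> A) G" using A(1) by (simp add: members_def)
  have "filtermap r G \<in> betaN"
    using evA r by (intro filtermap_in_betaN[OF G]) (auto elim: eventually_mono)
  moreover have "G = filtermap (\<lambda>x. c * x ^ n) (filtermap r G)"
  proof (rule filter_eqI)
    fix P
    have "eventually (\<lambda>x. c * r x ^ n = x) G"
      using evA by eventually_elim (use r in simp)
    then have "eventually (\<lambda>x. P x \<longleftrightarrow> P (c * r x ^ n)) G"
      by eventually_elim simp
    then show "eventually P G = eventually P (filtermap (\<lambda>x. c * x ^ n) (filtermap r G))"
      unfolding eventually_filtermap by (rule eventually_subst)
  qed
  ultimately show ?thesis
    using c(1) by blast
qed

theorem theorem3p4:
  fixes F :: "nat filter" and n :: nat
  assumes "F \<in> betaN - (\<lambda>m. principal {m}) ` Npos"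
    and "fe_minimal F"
    and "n \<in> Npos"
  shows "fe_minimal (filter_pow F n)"
proof -
  have F: "F \<in> betaN" and nonprincipal: "\<And>a. 0 < a \<Longrightarrow> F \<noteq> principal {a}"
    using assms(1) by auto
  have n: "0 < n" using assms(3) by simp
  have minimal: "fe_le F H" if "H \<in> betaN" "H \<noteq> principal {1}" "fe_le H F" for H
    using assms(2) that by (auto simp: fe_minimal_def fe_less_def)
  define E where "E = filtermap (\<lambda>x. x ^ n) F"
  have E: "E \<in> betaN"
    unfolding E_def using eventually_pos_betaN[OF F]
    by (intro filtermap_in_betaN[OF F]) (auto elim: eventually_mono)
  have "E \<noteq> principal {1}"
  proof
    assume "E = principal {1}"
    then have "eventually (\<lambda>x. x = 1) E" by (simp add: eventually_principal)
    then have "eventually (\<lambda>x. x = 1) F"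
      using n by (simp add: E_def eventually_filtermap)
    with betaN_eq_principal[OF F] nonprincipal[of 1] show False by simp
  qed
  moreover have "fe_le E G"
    if G: "G \<in> betaN" "G \<noteq> principal {1}" and le: "fe_le G E" for G
  proof -
    obtain c H where c: "0 < c" and H: "H \<in> betaN" and GH: "G = filtermap (\<lambda>x. c * x ^ n) H"
      using below_power_is_multiple_of_power[OF F G(1) n] le unfolding E_def by blast
    have "H \<noteq> principal {1}"
    proof
      assume "H = principal {1}"
      then have Gc: "G = principal {c}" by (simp add: GH)
      then obtain p where p: "prime p" "p dvd c"
        using G(2) prime_factor_nat[of c] by auto
      have "fe_le (principal {p}) F"
        unfolding fe_le_def
      proof
        fix B assume B: "B \<in> members F"
        then obtain A where A: "A \<in> members G" "fe_set_le A (set_pow B n)"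
          using le set_pow_in_members_filtermap[OF F B] by (auto simp: fe_le_def E_def)
        have "finite {c} \<and> {c} \<subseteq> A"
          using A(1) by (simp add: Gc members_def eventually_principal)
        from fe_set_leD[OF A(2) this] obtain k where "set_mult k {c} \<subseteq> set_pow B n"
          by blast
        then obtain b where b: "b \<in> B" "k * c = b ^ n"
          by (auto simp: set_mult_def set_pow_def)
        then have "p dvd b"
          using p by (metis dvd_mult prime_dvd_power)
        then obtain m where m: "b = m * p" by (metis dvd_div_mult_self)
        have "0 < m" using b(1) B m by (auto simp: members_def intro!: Nat.gr0I)
        then have "fe_set_le {p} B"
          using b(1) m by (auto simp: fe_set_le_def set_mult_def intro!: bexI[of _ m])
        moreover have "{p} \<in> members (principal {p})"
          using p(1) by (simp add: members_def eventually_principal prime_gt_0_nat)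
        ultimately show "\<exists>A\<in>members (principal {p}). fe_set_le A B" by blast
      qed
      moreover have "\<not> principal {p} \<le> principal {1}"
        using p(1) by auto
      then have "principal {p} \<noteq> principal {1}"
        using order.refl by metis
      ultimately have "fe_le F (principal {p})"
        using minimal principal_in_betaN[OF prime_gt_0_nat[OF p(1)]] by blast
      with principal_if_fe_le_principal[OF F] nonprincipal prime_gt_0_nat[OF p(1)]
      show False by blast
    qed
    moreover have "fe_le H F"
      using fe_le_root[OF F H n c] le by (simp add: GH E_def)
    ultimately have "fe_le F H" using H minimal by blast
    then show ?thesis
      using fe_le_filtermap_power[OF F H c] by (simp add: GH E_def)
  qed
  ultimately show ?thesis
    using E by (auto simp: fe_minimal_def fe_less_def filter_pow_eq_filtermap[OF F] E_def)
qed

end
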